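(* Let $K$ be a non-trivial (additively) idempotent semiring. Then the map $$\varphi=\varphi_K:\mathcal P\to\mathcal M(K):a\mapsto\overline a$$ (given on objects by $n\mapsto 2^n$) is a faithful involutive tensor category representation. In particular, for each $n\in\mathbb N$ the map $\varphi$ gives a faithful involutive representation of the monoid $\mathcal P_n$ by $2^n\times2^n$ matrices over $K$.
   Context: **Partition category.** $\mathbb N=\{0,1,2,\ldots\}$, $[n]=\{1,\ldots,n\}$ (so $[0]=\emptyset$). For $A\subseteq\mathbb N$, $A'=\{x':x\in A\}$ and $A''=\{x'':x\in A\}$ are two disjoint copies of $A$. $\mathcal P_{m,n}$ is the set of all set partitions of $[m]\cup[n]'$; the elements of $a\in\mathcal P_{m,n}$ are called $a$-blocks. A partition is identified with any graph whose connected components are its blocks. For $a\in\mathcal P_{m,n}$, $b\in\mathcal P_{n,t}$, the product graph $\Pi(a,b)$ has vertex set $[m]\cup[n]''\cup[t]'$ and edges those of $a$ (with each lower vertex $x'$ renamed $x''$) and of $b$ (with each upper vertex $x$ renamed $x''$). The product $ab\in\mathcal P_{m,t}$ is the partition in which $x,y\in[m]\cup[t]'$ lie in the same block iff they lie in the same connected component of $\Pi(a,b)$. The partition category $\mathcal P$ has object set $\mathbb N$, hom-sets $\mathcal P_{m,n}$ ($m\to n$), this composition, and identities $\iota_n=\{\{1,1'\},\ldots,\{n,n'\}\}$. $\mathcal P_n=\mathcal P_{n,n}$ is the partition monoid. The involution $a\mapsto a^*$, $\mathcal P_{m,n}\to\mathcal P_{n,m}$, swaps $i\leftrightarrow i'$.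 The tensor operation: for $a\in\mathcal P_{m,n}$, $b\in\mathcal P_{s,t}$, $a\oplus b\in\mathcal P_{m+s,n+t}$ has as blocks all $a$-blocks, together with $(X+m)\cup(Y+n)'$ for each $b$-block $X\cup Y'$ ($X\subseteq[s]$, $Y\subseteq[t]$). **Matrices.** A semiring $(K,+,\cdot,0,1)$ has $(K,+,0)$ a commutative monoid, $(K,\cdot,1)$ a monoid, multiplication distributing over addition, and $0$ a multiplicative zero; it is non-trivial if $0\ne1$, and (additively) idempotent if $1+1=1$. $\mathcal M(K)$ is the category with object set $\mathbb N$ and hom-sets $\mathcal M_{m,n}(K)$ of $m\times n$ matrices over $K$, with composition matrix multiplication, involution transpose, and tensor operation the Kronecker product $\otimes$ (objects multiply). Matrices in $\mathcal M_{2^m,2^n}(K)$ are regarded as having rows/columns indexed by subsets of $[m]$, $[n]$; under this indexing the Kronecker product of $A$ (indexed by subsets of $[m]$, $[n]$) and $B$ (indexed by subsets of $[s]$, $[t]$) is $(A\otimes B)_{X\cup(U+m),\,Y\cup(V+n)}=A_{X,Y}B_{U,V}$ for $X\subseteq[m]$, $U\subseteq[s]$, $Y\subseteq[n]$, $V\subseteq[t]$ (for instance, using the bijections $X\mapsto1+\sum_{x\in X}2^{n-x}$ from subsets of $[n]$ to $[2^n]$ this is the usual Kronecker product). **The map.** For $a\in\mathcal P_{m,n}$, $\overline a\in\mathcal M_{2^m,2^n}(K)$ is defined for $X\subseteq[m]$, $Y\subseteq[n]$ by $\overline a_{X,Y}=1$ if $X\cup Y'$ is a (possibly empty) union of $a$-blocks,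 and $\overline a_{X,Y}=0$ otherwise. **Representations.** A category representation is a functor; it is faithful if it is injective on objects and on morphisms, involutive if it preserves the involutions, and a tensor representation if it preserves the tensor operations. *)

theory Defs
  imports
    "HOL-Library.Disjoint_Sets"
    "HOL-Algebra.Group"
    "Jordan_Normal_Form.Matrix"
begin

section \<open>Categories with an involution and a tensor operation\<close>

text \<open>Every element of the type \<open>'o\<close> is an object, and composition is written in diagrammatic
  order: \<open>comp_of C m n t a b\<close> is the product \<open>ab\<close> of \<open>a : m \<rightarrow> n\<close> and
  \<open>b : n \<rightarrow> t\<close>. The operations take the objects involved as explicit arguments.\<close>

record ('o, 'm) tensor_cat =
  hom_of :: "'o \<Rightarrow> 'o \<Rightarrow> 'm set"
  comp_of :: "'o \<Rightarrow> 'o \<Rightarrow> 'o \<Rightarrow> 'm \<Rightarrow> 'm \<Rightarrow> 'm"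
  id_of :: "'o \<Rightarrow> 'm"
  star_of :: "'o \<Rightarrow> 'o \<Rightarrow> 'm \<Rightarrow> 'm"
  tensor_ob :: "'o \<Rightarrow> 'o \<Rightarrow> 'o"
  tensor_of :: "'o \<Rightarrow> 'o \<Rightarrow> 'o \<Rightarrow> 'o \<Rightarrow> 'm \<Rightarrow> 'm \<Rightarrow> 'm"

text \<open>Only the category axioms and the typing of the two extra operations are required. No
  compatibility of these operations with composition is imposed: over a non-commutative semiring
  transposition does not reverse products and the Kronecker product is not functorial.\<close>

definition is_category :: "('o, 'm) tensor_cat \<Rightarrow> bool" where
  "is_category C \<longleftrightarrow>
    (\<forall>m n m' n'. hom_of C m n \<inter> hom_of C m' n' \<noteq> {} \<longrightarrow> m = m' \<and> n = n') \<and>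
    (\<forall>m n t. \<forall>a \<in> hom_of C m n. \<forall>b \<in> hom_of C n t. comp_of C m n t a b \<in> hom_of C m t) \<and>
    (\<forall>m n s t. \<forall>a \<in> hom_of C m n. \<forall>b \<in> hom_of C n s. \<forall>c \<in> hom_of C s t.
      comp_of C m s t (comp_of C m n s a b) c = comp_of C m n t a (comp_of C n s t b c)) \<and>
    (\<forall>n. id_of C n \<in> hom_of C n n) \<and>
    (\<forall>m n. \<forall>a \<in> hom_of C m n.
      comp_of C m m n (id_of C m) a = a \<and> comp_of C m n n a (id_of C n) = a)"

definition is_tensor_cat :: "('o, 'm) tensor_cat \<Rightarrow> bool" where
  "is_tensor_cat C \<longleftrightarrow> is_category C \<and>
    (\<forall>m n. \<forall>a \<in> hom_of C m n. star_of C m n a \<in> hom_of C n m) \<and>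
    (\<forall>m n s t. \<forall>a \<in> hom_of C m n. \<forall>b \<in> hom_of C s t.
      tensor_of C m n s t a b \<in> hom_of C (tensor_ob C m s) (tensor_ob C n t))"

text \<open>A map between such categories is given by \<open>F\<close> on objects and by \<open>f m n\<close> on the morphisms
  \<open>m \<rightarrow> n\<close>.\<close>

definition is_functor ::
  "('o, 'm) tensor_cat \<Rightarrow> ('p, 'n) tensor_cat \<Rightarrow> ('o \<Rightarrow> 'p) \<Rightarrow> ('o \<Rightarrow> 'o \<Rightarrow> 'm \<Rightarrow> 'n) \<Rightarrow> bool" where
  "is_functor C D F f \<longleftrightarrow> is_category C \<and> is_category D \<and>
    (\<forall>m n. \<forall>a \<in> hom_of C m n. f m n a \<in> hom_of D (F m) (F n)) \<and>
    (\<forall>m n t. \<forall>a \<in> hom_of C m n. \<forall>b \<in> hom_of C n t.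
      f m t (comp_of C m n t a b) = comp_of D (F m) (F n) (F t) (f m n a) (f n t b)) \<and>
    (\<forall>n. f n n (id_of C n) = id_of D (F n))"

definition faithful_map ::
  "('o, 'm) tensor_cat \<Rightarrow> ('o \<Rightarrow> 'p) \<Rightarrow> ('o \<Rightarrow> 'o \<Rightarrow> 'm \<Rightarrow> 'n) \<Rightarrow> bool" where
  "faithful_map C F f \<longleftrightarrow> inj F \<and>
    (\<forall>m n m' n'. \<forall>a \<in> hom_of C m n. \<forall>b \<in> hom_of C m' n'.
      f m n a = f m' n' b \<longrightarrow> m = m' \<and> n = n' \<and> a = b)"

definition involutive_map ::
  "('o, 'm) tensor_cat \<Rightarrow> ('p, 'n) tensor_cat \<Rightarrow> ('o \<Rightarrow> 'p) \<Rightarrow> ('o \<Rightarrow> 'o \<Rightarrow> 'm \<Rightarrow> 'n) \<Rightarrow> bool" where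
  "involutive_map C D F f \<longleftrightarrow>
    (\<forall>m n. \<forall>a \<in> hom_of C m n. f n m (star_of C m n a) = star_of D (F m) (F n) (f m n a))"

definition tensor_map ::
  "('o, 'm) tensor_cat \<Rightarrow> ('p, 'n) tensor_cat \<Rightarrow> ('o \<Rightarrow> 'p) \<Rightarrow> ('o \<Rightarrow> 'o \<Rightarrow> 'm \<Rightarrow> 'n) \<Rightarrow> bool" where
  "tensor_map C D F f \<longleftrightarrow>
    (\<forall>m n. F (tensor_ob C m n) = tensor_ob D (F m) (F n)) \<and>
    (\<forall>m n s t. \<forall>a \<in> hom_of C m n. \<forall>b \<in> hom_of C s t.
      f (tensor_ob C m s) (tensor_ob C n t) (tensor_of C m n s t a b) =
      tensor_of D (F m) (F n) (F s) (F t) (f m n a) (f s t b))"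

definition endo_monoid :: "('o, 'm) tensor_cat \<Rightarrow> 'o \<Rightarrow> 'm monoid" where
  "endo_monoid C n = \<lparr>carrier = hom_of C n n, mult = comp_of C n n n, one = id_of C n\<rparr>"


section \<open>The partition category\<close>

text \<open>\<open>Upper x\<close>, \<open>Middle x\<close>, \<open>Lower x\<close> stand for \<open>x\<close>, \<open>x''\<close>, \<open>x'\<close> respectively; middle vertices
  occur only in product graphs.\<close>

datatype vertex = Upper nat | Middle nat | Lower nat

definition vertices :: "nat \<Rightarrow> nat \<Rightarrow> vertex set" where
  "vertices m n = Upper ` {1..m} \<union> Lower ` {1..n}"

definition partitions :: "nat \<Rightarrow> nat \<Rightarrow> vertex set set set" where
  "partitions m n = {a. partition_on (vertices m n) a}"

fun lower_to_middle :: "vertex \<Rightarrow> vertex" where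
  "lower_to_middle (Lower x) = Middle x"
| "lower_to_middle v = v"

fun upper_to_middle :: "vertex \<Rightarrow> vertex" where
  "upper_to_middle (Upper x) = Middle x"
| "upper_to_middle v = v"

fun flip :: "vertex \<Rightarrow> vertex" where
  "flip (Upper x) = Lower x"
| "flip (Lower x) = Upper x"
| "flip (Middle x) = Middle x"

fun shift :: "nat \<Rightarrow> nat \<Rightarrow> vertex \<Rightarrow> vertex" where
  "shift m n (Upper x) = Upper (x + m)"
| "shift m n (Lower x) = Lower (x + n)"
| "shift m n (Middle x) = Middle x"

text \<open>A partition is represented by the graph in which any two vertices of a common block are
  adjacent.\<close>

definition edges :: "vertex set set \<Rightarrow> vertex rel" where
  "edges a = (\<Union>B\<in>a. B \<times> B)"

definition product_edges :: "vertex set set \<Rightarrow> vertex set set \<Rightarrow> vertex rel" where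
  "product_edges a b =
    edges ((`) lower_to_middle ` a) \<union> edges ((`) upper_to_middle ` b)"

text \<open>The edge relation is symmetric, so being in the same connected component of the product graph
  is its reflexive transitive closure.\<close>

definition partition_product ::
  "nat \<Rightarrow> nat \<Rightarrow> vertex set set \<Rightarrow> vertex set set \<Rightarrow> vertex set set" where
  "partition_product m t a b =
    vertices m t // {(x, y). x \<in> vertices m t \<and> y \<in> vertices m t \<and> (x, y) \<in> (product_edges a b)\<^sup>*}"

definition partition_id :: "nat \<Rightarrow> vertex set set" where
  "partition_id n = {{Upper i, Lower i} | i. i \<in> {1..n}}"

definition partition_star :: "vertex set set \<Rightarrow> vertex set set" where
  "partition_star a = (`) flip ` a"

definition partition_tensor ::
  "nat \<Rightarrow> nat \<Rightarrow> vertex set set \<Rightarrow> vertex set set \<Rightarrow> vertex set set" where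
  "partition_tensor m n a b = a \<union> (`) (shift m n) ` b"

definition partition_cat :: "(nat, vertex set set) tensor_cat" where
  "partition_cat = \<lparr>
    hom_of = partitions,
    comp_of = (\<lambda>m n t. partition_product m t),
    id_of = partition_id,
    star_of = (\<lambda>m n. partition_star),
    tensor_ob = (+),
    tensor_of = (\<lambda>m n s t. partition_tensor m n)\<rparr>"


section \<open>The category of matrices over a semiring\<close>

definition kronecker :: "'k::semiring_1 mat \<Rightarrow> 'k mat \<Rightarrow> 'k mat" where
  "kronecker A B = mat (dim_row A * dim_row B) (dim_col A * dim_col B)
    (\<lambda>(i, j). A $$ (i div dim_row B, j div dim_col B) * B $$ (i mod dim_row B, j mod dim_col B))"

definition matrix_cat :: "(nat, 'k::semiring_1 mat) tensor_cat" where
  "matrix_cat = \<lparr>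
    hom_of = carrier_mat,
    comp_of = (\<lambda>m n t. (*)),
    id_of = one_mat,
    star_of = (\<lambda>m n. transpose_mat),
    tensor_ob = (*),
    tensor_of = (\<lambda>m n s t. kronecker)\<rparr>"


section \<open>The matrix of a partition\<close>

text \<open>Rows and columns are numbered from 0, so the bijection from the subsets of \<open>{1..n}\<close> to the
  indices is \<open>X \<mapsto> (\<Sum>x\<in>X. 2 ^ (n - x))\<close>.\<close>

definition subset_index :: "nat \<Rightarrow> nat set \<Rightarrow> nat" where
  "subset_index n X = (\<Sum>x\<in>X. 2 ^ (n - x))"

definition index_subset :: "nat \<Rightarrow> nat \<Rightarrow> nat set" where
  "index_subset n = the_inv_into (Pow {1..n}) (subset_index n)"

definition union_of_blocks :: "vertex set set \<Rightarrow> vertex set \<Rightarrow> bool" where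
  "union_of_blocks a Z \<longleftrightarrow> (\<exists>S\<subseteq>a. Z = \<Union>S)"

definition bar :: "nat \<Rightarrow> nat \<Rightarrow> vertex set set \<Rightarrow> 'k::semiring_1 mat" where
  "bar m n a = mat (2 ^ m) (2 ^ n)
    (\<lambda>(i, j). if union_of_blocks a (Upper ` index_subset m i \<union> Lower ` index_subset n j)
               then 1 else 0)"

lemma subset_index_Suc:
  assumes "X \<subseteq> {1..Suc n}"
  shows "subset_index (Suc n) X = 2 * subset_index n (X - {Suc n}) + (if Suc n \<in> X then 1 else 0)"
proof -
  have fin: "finite X" using assms finite_subset by blast
  have "(\<Sum>x\<in>X - {Suc n}. (2::nat) ^ (Suc n - x)) = (\<Sum>x\<in>X - {Suc n}. 2 * 2 ^ (n - x))"
  proof (rule sum.cong)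
    fix x assume "x \<in> X - {Suc n}"
    then have "x \<le> n" using assms by fastforce
    then show "(2::nat) ^ (Suc n - x) = 2 * 2 ^ (n - x)" by (simp add: Suc_diff_le)
  qed simp
  moreover have "(\<Sum>x\<in>X. (2::nat) ^ (Suc n - x)) =
      (\<Sum>x\<in>X - {Suc n}. 2 ^ (Suc n - x)) + (if Suc n \<in> X then 1 else 0)"
    using fin by (auto simp: sum.remove)
  ultimately show ?thesis
    by (simp add: subset_index_def sum_distrib_left)
qed

lemma bij_betw_subset_index: "bij_betw (subset_index n) (Pow {1..n}) {..<2 ^ n}"
proof -
  have lt: "X \<subseteq> {1..n} \<Longrightarrow> subset_index n X < 2 ^ n" for X n
  proof (induction n arbitrary: X)
    case (Suc n)
    have "X - {Suc n} \<subseteq> {1..n}" using Suc.prems by force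
    from Suc.IH[OF this] show ?case using subset_index_Suc[OF Suc.prems] by auto
  qed (simp add: subset_index_def)
  have inj: "X \<subseteq> {1..n} \<Longrightarrow> Y \<subseteq> {1..n} \<Longrightarrow> subset_index n X = subset_index n Y \<Longrightarrow> X = Y" for X Y n
  proof (induction n arbitrary: X Y)
    case (Suc n)
    have sub: "X - {Suc n} \<subseteq> {1..n}" "Y - {Suc n} \<subseteq> {1..n}" using Suc.prems by force+
    have "2 * subset_index n (X - {Suc n}) + (if Suc n \<in> X then 1 else 0) =
          2 * subset_index n (Y - {Suc n}) + (if Suc n \<in> Y then 1 else 0)"
      using Suc.prems(3) subset_index_Suc[OF Suc.prems(1)] subset_index_Suc[OF Suc.prems(2)] by simp
    then have "Suc n \<in> X \<longleftrightarrow> Suc n \<in> Y" "subset_index n (X - {Suc n}) = subset_index n (Y - {Suc n})"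
      by (auto split: if_splits) presburger+
    with Suc.IH[OF sub] show ?case by blast
  qed simp
  have "inj_on (subset_index n) (Pow {1..n})" using inj by (auto intro!: inj_onI)
  moreover have "subset_index n ` Pow {1..n} \<subseteq> {..<2 ^ n}" using lt by auto
  moreover have "card (Pow {1..n}) = card {..<(2::nat) ^ n}" by (simp add: card_Pow)
  ultimately show ?thesis
    by (metis bij_betw_def card_image card_subset_eq finite_lessThan)
qed

lemma bar_entry:
  assumes "X \<subseteq> {1..m}" "Y \<subseteq> {1..n}"
  shows "bar m n a $$ (subset_index m X, subset_index n Y) =
    (if union_of_blocks a (Upper ` X \<union> Lower ` Y) then 1 else 0)"
proof -
  have inv: "index_subset k (subset_index k Z) = Z \<and> subset_index k Z < 2 ^ k" if "Z \<subseteq> {1..k}" for k Z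
    using bij_betw_subset_index[of k] that
    by (auto simp: index_subset_def bij_betw_def intro!: the_inv_into_f_f)
  show ?thesis using inv[OF assms(1)] inv[OF assms(2)] by (simp add: bar_def)
qed

end

theory Submission
  imports Defs
begin

text \<open>
  A partition is recovered from the family of unions of its blocks, and such a family is easy to
  handle: \<open>Z\<close> is a union of blocks iff every block lies inside \<open>Z\<close> or misses it, that is, iff \<open>Z\<close> is
  closed under the edges of any graph representing the partition. All operations are transparent
  in these terms. Relabelling vertices by \<open>g\<close> amounts to pulling \<open>Z\<close> back along \<open>g\<close>, which settles
  the involution and the tensor operation. For the product, a set \<open>X \<union> Z'\<close> closed
  for \<open>ab\<close> generates a closed set of the product graph that adds only middle vertices \<open>Y''\<close>;
  hence \<open>X \<union> Z'\<close> is closed for \<open>ab\<close> iff some \<open>Y\<close> makes \<open>X \<union> Y'\<close> closed for \<open>a\<close> and \<open>Y \<union> Z'\<close>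
  closed for \<open>b\<close> (\<open>saturated_product_iff\<close>). So a partition acts as a binary
  relation between subsets, and the product of partitions is composition of relations.

  With the uniqueness of a partition with given closed sets (\<open>partitions_eqI\<close>), the
  category axioms for partitions follow from those of relations. A 0-1 matrix over an idempotent
  semiring is also a binary relation, and the matrix product is again composition, because
  a sum of zeros and ones is \<open>1\<close> as soon as one summand is. The matrix of \<open>a\<close> is the relation of \<open>a\<close>,
  and it determines this relation because \<open>0 \<noteq> 1\<close>.
\<close>

section \<open>Saturated sets of a partition\<close>

definition saturated :: "'a set set \<Rightarrow> 'a set \<Rightarrow> bool" where
  "saturated a Z \<longleftrightarrow> (\<forall>B\<in>a. B \<subseteq> Z \<or> B \<inter> Z = {})"

lemma saturatedI:
  "(\<And>B x y. B \<in> a \<Longrightarrow> x \<in> B \<Longrightarrow> x \<in> Z \<Longrightarrow> y \<in> B \<Longrightarrow> y \<in> Z) \<Longrightarrow> saturated a Z"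
  unfolding saturated_def by blast

lemma saturatedD:
  "saturated a Z \<Longrightarrow> B \<in> a \<Longrightarrow> x \<in> B \<Longrightarrow> x \<in> Z \<Longrightarrow> y \<in> B \<Longrightarrow> y \<in> Z"
  unfolding saturated_def by blast

definition two_rows :: "nat set \<Rightarrow> nat set \<Rightarrow> vertex set" where
  "two_rows X Y = Upper ` X \<union> Lower ` Y"

lemma union_of_blocks_iff_saturated:
  assumes "partition_on V a" "Z \<subseteq> V"
  shows "union_of_blocks a Z \<longleftrightarrow> saturated a Z"
proof
  assume "union_of_blocks a Z"
  then obtain S where S: "S \<subseteq> a" "Z = \<Union>S" by (auto simp: union_of_blocks_def)
  show "saturated a Z"
    unfolding saturated_def
  proof
    fix B assume B: "B \<in> a"
    show "B \<subseteq> Z \<or> B \<inter> Z = {}"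
    proof (cases "B \<in> S")
      case False
      then have "B \<inter> C = {}" if "C \<in> S" for C
        using that B S(1) disjointD[OF partition_onD2[OF assms(1)], of B C] by auto
      then show ?thesis using S(2) by blast
    qed (use S(2) in blast)
  qed
next
  assume sat: "saturated a Z"
  have "Z = \<Union>{B \<in> a. B \<subseteq> Z}"
  proof
    show "Z \<subseteq> \<Union>{B \<in> a. B \<subseteq> Z}"
    proof
      fix x assume x: "x \<in> Z"
      then obtain B where "B \<in> a" "x \<in> B"
        using assms(2) partition_onD1[OF assms(1)] by blast
      then show "x \<in> \<Union>{B \<in> a. B \<subseteq> Z}" using saturatedD[OF sat] x by blast
    qed
  qed blast
  then show "union_of_blocks a Z"
    unfolding union_of_blocks_def by (intro exI[of _ "{B \<in> a. B \<subseteq> Z}"] conjI) blast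
qed

lemma saturated_image_iff: "saturated ((`) g ` a) Z \<longleftrightarrow> saturated a (g -` Z)"
proof -
  have "g ` B \<inter> Z = {} \<longleftrightarrow> B \<inter> g -` Z = {}" for B by blast
  then show ?thesis by (simp add: saturated_def image_subset_iff_subset_vimage)
qed

lemma saturated_Un_iff: "saturated (a \<union> b) Z \<longleftrightarrow> saturated a Z \<and> saturated b Z"
  by (simp add: saturated_def ball_Un)

lemma saturated_cong:
  assumes "partition_on V a" "\<And>v. v \<in> V \<Longrightarrow> v \<in> Z \<longleftrightarrow> v \<in> W"
  shows "saturated a Z \<longleftrightarrow> saturated a W"
proof -
  have "B \<subseteq> V" if "B \<in> a" for B using that partition_onD1[OF assms(1)] by blast
  then have "(B \<subseteq> Z \<or> B \<inter> Z = {}) \<longleftrightarrow> (B \<subseteq> W \<or> B \<inter> W = {})" if "B \<in> a" for B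
    using that assms(2) by blast
  then show ?thesis unfolding saturated_def by blast
qed

lemma saturated_block:
  assumes "partition_on V a" "B \<in> a"
  shows "saturated a B"
  using partition_onD2[OF assms(1)] assms(2) unfolding saturated_def disjoint_def by blast

text \<open>A block is a minimal nonempty saturated set, so the saturated sets determine the blocks.\<close>

lemma partition_on_eqI:
  assumes a: "partition_on V a" and b: "partition_on V b"
    and eq: "\<And>Z. Z \<subseteq> V \<Longrightarrow> saturated a Z \<longleftrightarrow> saturated b Z"
  shows "a = b"
proof -
  have sub: "a \<subseteq> b"
    if a: "partition_on V a" and b: "partition_on V b"
      and eq: "\<And>Z. Z \<subseteq> V \<Longrightarrow> saturated a Z \<longleftrightarrow> saturated b Z" for a b
  proof
    fix B assume B: "B \<in> a"
    obtain x where x: "x \<in> B" using B partition_onD3[OF a] by fastforce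
    obtain C where C: "C \<in> b" "x \<in> C"
      using x B partition_onD1[OF a] partition_onD1[OF b] by blast
    have "saturated b B" "saturated a C"
      using eq saturated_block[OF a B] saturated_block[OF b C(1)] B C(1)
        partition_onD1[OF a] partition_onD1[OF b] by blast+
    then have "B = C" using x C B unfolding saturated_def by blast
    then show "B \<in> b" using C by simp
  qed
  show ?thesis using sub[OF a b eq] sub[OF b a] eq by blast
qed

lemma mem_two_rows [simp]:
  "Upper x \<in> two_rows X Y \<longleftrightarrow> x \<in> X"
  "Lower x \<in> two_rows X Y \<longleftrightarrow> x \<in> Y"
  "Middle x \<notin> two_rows X Y"
  by (auto simp: two_rows_def)

lemma mem_vertices [simp]:
  "Upper x \<in> vertices m n \<longleftrightarrow> x \<in> {1..m}"
  "Lower x \<in> vertices m n \<longleftrightarrow> x \<in> {1..n}"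
  "Middle x \<notin> vertices m n"
  by (auto simp: vertices_def)

lemma two_rows_subset_vertices:
  "X \<subseteq> {1..m} \<Longrightarrow> Y \<subseteq> {1..n} \<Longrightarrow> two_rows X Y \<subseteq> vertices m n"
  unfolding two_rows_def vertices_def by blast

lemma subset_vertices_cases:
  assumes "Z \<subseteq> vertices m n"
  obtains X Y where "X \<subseteq> {1..m}" "Y \<subseteq> {1..n}" "Z = two_rows X Y"
proof
  show "Upper -` Z \<subseteq> {1..m}" "Lower -` Z \<subseteq> {1..n}"
    "Z = two_rows (Upper -` Z) (Lower -` Z)"
    using assms unfolding two_rows_def vertices_def by auto
qed

lemma partitionsD: "a \<in> partitions m n \<Longrightarrow> partition_on (vertices m n) a"
  by (simp add: partitions_def)

lemma partitions_eqI:
  assumes "a \<in> partitions m n" "b \<in> partitions m n"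
    and "\<And>X Y. X \<subseteq> {1..m} \<Longrightarrow> Y \<subseteq> {1..n} \<Longrightarrow>
      saturated a (two_rows X Y) \<longleftrightarrow> saturated b (two_rows X Y)"
  shows "a = b"
  using assms(1,2)[THEN partitionsD]
proof (rule partition_on_eqI)
  show "saturated a Z \<longleftrightarrow> saturated b Z" if "Z \<subseteq> vertices m n" for Z
    using that assms(3) by (metis subset_vertices_cases)
qed

section \<open>The operations on partitions\<close>

lemma equiv_components:
  assumes "sym r"
  shows "equiv V {(x, y). x \<in> V \<and> y \<in> V \<and> (x, y) \<in> r\<^sup>*}"
proof (rule equivI)
  show "sym {(x, y). x \<in> V \<and> y \<in> V \<and> (x, y) \<in> r\<^sup>*}"
    using sym_rtrancl[OF assms] by (auto simp: sym_def)
qed (auto simp: refl_on_def intro!: transI)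

lemma sym_product_edges: "sym (product_edges a b)"
  unfolding product_edges_def edges_def sym_def by blast

lemma partition_product_in_partitions: "partition_product m t a b \<in> partitions m t"
  unfolding partition_product_def partitions_def
  by (simp add: partition_on_quotient equiv_components sym_product_edges)

lemma partition_id_in_partitions: "partition_id n \<in> partitions n n"
  unfolding partitions_def partition_id_def vertices_def mem_Collect_eq
proof (rule partition_onI)
  show "\<Union>{{Upper i, Lower i} | i. i \<in> {1..n}} = Upper ` {1..n} \<union> Lower ` {1..n}" by blast
qed (auto simp: disjnt_def)

lemma partition_on_image:
  assumes "partition_on V a" "inj_on f V"
  shows "partition_on (f ` V) ((`) f ` a)"
proof -
  have "{} \<notin> (`) f ` a" using partition_onD3[OF assms(1)] by blast
  then show ?thesis using partition_on_inj_image[OF assms] by simp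
qed

lemma flip_flip [simp]: "flip (flip v) = v"
  by (cases v) auto

lemma partition_star_in_partitions:
  assumes "a \<in> partitions m n"
  shows "partition_star a \<in> partitions n m"
proof -
  have "inj flip" by (metis injI flip_flip)
  moreover have "flip ` vertices m n = vertices n m"
    by (auto simp: vertices_def image_Un image_image)
  ultimately show ?thesis
    using partition_on_image[OF partitionsD[OF assms], of flip]
    by (simp add: partition_star_def partitions_def inj_on_subset)
qed

lemma partition_on_disjoint_Un:
  assumes "partition_on V a" "partition_on W b" "V \<inter> W = {}"
  shows "partition_on (V \<union> W) (a \<union> b)"
proof (rule partition_onI)
  have cross: "disjnt p q" if "p \<in> a" "q \<in> b" for p q
    using that assms partition_onD1 unfolding disjnt_def by blast
  show "disjnt p q" if "p \<in> a \<union> b" "q \<in> a \<union> b" "p \<noteq> q" for p q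
    using that cross cross[THEN disjnt_sym] partition_onD2[OF assms(1)] partition_onD2[OF assms(2)]
    by (auto simp: pairwise_def)
  show "\<Union>(a \<union> b) = V \<union> W"
    using partition_onD1[OF assms(1)] partition_onD1[OF assms(2)] by simp
  show "{} \<notin> a \<union> b"
    using partition_onD3[OF assms(1)] partition_onD3[OF assms(2)] by simp
qed

lemma image_add_atLeastAtMost_Suc: "(\<lambda>x. x + m) ` {1..s} = {m + 1..m + (s::nat)}"
  using image_add_atLeastAtMost'[of m 1 s] by (simp add: add.commute)

lemma partition_tensor_in_partitions:
  assumes "a \<in> partitions m n" "b \<in> partitions s t"
  shows "partition_tensor m n a b \<in> partitions (m + s) (n + t)"
proof -
  have img: "shift m n ` vertices s t = Upper ` {m + 1..m + s} \<union> Lower ` {n + 1..n + t}"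
    unfolding image_add_atLeastAtMost_Suc[symmetric] image_image
    by (simp add: vertices_def image_Un image_image)
  have "inj (shift m n)"
  proof (rule injI)
    show "u = v" if "shift m n u = shift m n v" for u v
      using that by (cases u; cases v) auto
  qed
  then have "partition_on (shift m n ` vertices s t) ((`) (shift m n) ` b)"
    by (intro partition_on_image partitionsD assms) (blast intro: inj_on_subset)
  moreover have "vertices m n \<inter> shift m n ` vertices s t = {}"
    unfolding img by (auto simp: vertices_def)
  moreover have "vertices m n \<union> shift m n ` vertices s t = vertices (m + s) (n + t)"
  proof -
    have "{1..k + l} = {1..k} \<union> {k + 1..k + l}" for k l :: nat by auto
    then show ?thesis unfolding img by (simp add: vertices_def image_Un Un_ac)
  qed
  ultimately show ?thesis
    using partition_on_disjoint_Un[OF partitionsD[OF assms(1)],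
        of "shift m n ` vertices s t" "(`) (shift m n) ` b"]
    by (simp add: partition_tensor_def partitions_def)
qed

section \<open>The operations in terms of saturated sets\<close>

lemma saturated_id_iff:
  assumes "X \<subseteq> {1..n}" "Y \<subseteq> {1..n}"
  shows "saturated (partition_id n) (two_rows X Y) \<longleftrightarrow> X = Y"
proof -
  have "partition_id n = (\<lambda>i. {Upper i, Lower i}) ` {1..n}"
    by (auto simp: partition_id_def)
  then have "saturated (partition_id n) (two_rows X Y) \<longleftrightarrow> (\<forall>i\<in>{1..n}. i \<in> X \<longleftrightarrow> i \<in> Y)"
    by (auto simp: saturated_def)
  then show ?thesis using assms by blast
qed

lemma saturated_star_iff: "saturated (partition_star a) (two_rows X Y) \<longleftrightarrow> saturated a (two_rows Y X)"
proof -
  have "flip v \<in> two_rows X Y \<longleftrightarrow> v \<in> two_rows Y X" for v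
    by (cases v) simp_all
  then have "flip -` two_rows X Y = two_rows Y X" by blast
  then show ?thesis by (simp add: partition_star_def saturated_image_iff)
qed

lemma saturated_tensor_iff:
  assumes a: "a \<in> partitions m n" and b: "b \<in> partitions s t"
    and X: "X \<subseteq> {1..m}" and Y: "Y \<subseteq> {1..n}" and U: "U \<subseteq> {1..s}" and V: "V \<subseteq> {1..t}"
  shows "saturated (partition_tensor m n a b)
      (two_rows (X \<union> (\<lambda>x. x + m) ` U) (Y \<union> (\<lambda>x. x + n) ` V)) \<longleftrightarrow>
    saturated a (two_rows X Y) \<and> saturated b (two_rows U V)"
    (is "saturated _ ?Z \<longleftrightarrow> _")
proof -
  \<comment> \<open>The positions up to \<open>k\<close> see only the first set, and those above \<open>k\<close> only the shifted one.\<close>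
  have old: "x \<in> A \<union> (\<lambda>x. x + k) ` B \<longleftrightarrow> x \<in> A"
    if "x \<le> k" "B \<subseteq> {1..l}" for A B x and k l :: nat
    using that by auto
  have new: "x + k \<in> A \<union> (\<lambda>x. x + k) ` B \<longleftrightarrow> x \<in> B"
    if "1 \<le> x" "A \<subseteq> {1..k}" for A B x and k :: nat
    using that by auto
  have "v \<in> ?Z \<longleftrightarrow> v \<in> two_rows X Y" if "v \<in> vertices m n" for v
  proof (cases v)
    case (Upper x)
    then have "x \<le> m" using that by simp
    then show ?thesis unfolding Upper mem_two_rows by (rule old[OF _ U])
  next
    case (Lower x)
    then have "x \<le> n" using that by simp
    then show ?thesis unfolding Lower mem_two_rows by (rule old[OF _ V])
  qed (use that in simp)
  then have "saturated a ?Z \<longleftrightarrow> saturated a (two_rows X Y)"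
    by (rule saturated_cong[OF partitionsD[OF a]])
  moreover have "v \<in> shift m n -` ?Z \<longleftrightarrow> v \<in> two_rows U V" if "v \<in> vertices s t" for v
  proof (cases v)
    case (Upper x)
    then have "1 \<le> x" using that by simp
    then show ?thesis unfolding Upper vimage_eq shift.simps mem_two_rows by (rule new[OF _ X])
  next
    case (Lower x)
    then have "1 \<le> x" using that by simp
    then show ?thesis unfolding Lower vimage_eq shift.simps mem_two_rows by (rule new[OF _ Y])
  qed (use that in simp)
  then have "saturated b (shift m n -` ?Z) \<longleftrightarrow> saturated b (two_rows U V)"
    by (rule saturated_cong[OF partitionsD[OF b]])
  ultimately show ?thesis
    by (simp add: partition_tensor_def saturated_Un_iff saturated_image_iff)
qed

text \<open>Saturation for the components of a graph is closure under its edges, provided that paths are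
  allowed to leave \<open>V\<close>: each closed set of the graph restricts to a saturated one, and each
  saturated set is such a restriction, namely of the set of vertices reachable from it.\<close>

lemma saturated_components_iff:
  assumes "sym r" "Z \<subseteq> V"
  shows "saturated (V // {(x, y). x \<in> V \<and> y \<in> V \<and> (x, y) \<in> r\<^sup>*}) Z \<longleftrightarrow>
    (\<exists>W. r `` W \<subseteq> W \<and> W \<inter> V = Z)"
    (is "saturated (V // ?R) Z \<longleftrightarrow> _")
proof
  assume sat: "saturated (V // ?R) Z"
  have "r\<^sup>* `` Z \<inter> V \<subseteq> Z"
  proof
    fix y assume "y \<in> r\<^sup>* `` Z \<inter> V"
    then obtain x where x: "x \<in> Z" "(x, y) \<in> r\<^sup>*" "y \<in> V" by blast
    have xV: "x \<in> V" using x(1) assms(2) by blast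
    have "?R `` {x} \<in> V // ?R" using xV by (rule quotientI)
    moreover have "x \<in> ?R `` {x}" "y \<in> ?R `` {x}" using x xV by auto
    ultimately show "y \<in> Z" using saturatedD[OF sat _ _ x(1)] by blast
  qed
  then have "r\<^sup>* `` Z \<inter> V = Z" using assms(2) by blast
  moreover have "r `` (r\<^sup>* `` Z) \<subseteq> r\<^sup>* `` Z" by (auto intro: rtrancl_into_rtrancl)
  ultimately show "\<exists>W. r `` W \<subseteq> W \<and> W \<inter> V = Z" by (intro exI conjI)
next
  assume "\<exists>W. r `` W \<subseteq> W \<and> W \<inter> V = Z"
  then obtain W where W: "r `` W \<subseteq> W" "W \<inter> V = Z" by blast
  have closed: "y \<in> W" if "(x, y) \<in> r\<^sup>*" "x \<in> W" for x y
    using Image_closed_trancl[OF W(1)] that by blast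
  show "saturated (V // ?R) Z"
  proof (rule saturatedI)
    fix B x y assume B: "B \<in> V // ?R" and x: "x \<in> B" "x \<in> Z" and y: "y \<in> B"
    obtain v where "B = ?R `` {v}" using B by (rule quotientE)
    then have v: "(v, x) \<in> r\<^sup>*" "(v, y) \<in> r\<^sup>*" "y \<in> V" using x(1) y by auto
    have "(x, v) \<in> r\<^sup>*" using sym_rtrancl[OF assms(1)] v(1) by (rule symD)
    then have "(x, y) \<in> r\<^sup>*" using v(2) by (rule rtrancl_trans)
    then show "y \<in> Z" using closed x(2) v(3) W(2) by blast
  qed
qed

lemma closed_product_edges_iff:
  "product_edges a b `` W \<subseteq> W \<longleftrightarrow>
    saturated a (lower_to_middle -` W) \<and> saturated b (upper_to_middle -` W)"
proof -
  have "edges c `` W \<subseteq> W \<longleftrightarrow> saturated c W" for c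
    unfolding edges_def saturated_def by blast
  then show ?thesis
    by (simp add: product_edges_def Un_Image saturated_image_iff)
qed

text \<open>A closed set of the product graph is a closed set of \<open>a\<close> and a closed set of \<open>b\<close> that agree on
  the middle row. Here \<open>Y\<close> is the trace on that row of a closed set with outer trace
  \<open>X \<union> Z'\<close>.\<close>

lemma saturated_product_iff:
  assumes a: "a \<in> partitions m n" and b: "b \<in> partitions n t"
    and X: "X \<subseteq> {1..m}" and Z: "Z \<subseteq> {1..t}"
  shows "saturated (partition_product m t a b) (two_rows X Z) \<longleftrightarrow>
    (\<exists>Y\<subseteq>{1..n}. saturated a (two_rows X Y) \<and> saturated b (two_rows Y Z))"
proof -
  \<comment> \<open>The factor \<open>a\<close> sees only the upper and middle vertices of \<open>W\<close>, and \<open>b\<close> only the middle and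
    lower ones. Vertices outside the product graph do not matter, so \<open>W\<close> is arbitrary there.\<close>
  have halves: "product_edges a b `` W \<subseteq> W \<longleftrightarrow>
      saturated a (two_rows X Y) \<and> saturated b (two_rows Y Z)"
    if W: "W \<inter> vertices m t = two_rows X Z" and Y: "Y = {1..n} \<inter> Middle -` W" for W Y
  proof -
    have outer: "Upper x \<in> W \<longleftrightarrow> x \<in> X" if "x \<in> {1..m}" for x
    proof -
      have "Upper x \<in> W \<longleftrightarrow> Upper x \<in> W \<inter> vertices m t" using that by simp
      then show ?thesis by (simp add: W)
    qed
    have outer': "Lower x \<in> W \<longleftrightarrow> x \<in> Z" if "x \<in> {1..t}" for x
    proof -
      have "Lower x \<in> W \<longleftrightarrow> Lower x \<in> W \<inter> vertices m t" using that by simp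
      then show ?thesis by (simp add: W)
    qed
    have "v \<in> lower_to_middle -` W \<longleftrightarrow> v \<in> two_rows X Y" if "v \<in> vertices m n" for v
      using that outer by (cases v) (simp_all add: Y)
    then have "saturated a (lower_to_middle -` W) \<longleftrightarrow> saturated a (two_rows X Y)"
      by (rule saturated_cong[OF partitionsD[OF a]])
    moreover have "v \<in> upper_to_middle -` W \<longleftrightarrow> v \<in> two_rows Y Z" if "v \<in> vertices n t" for v
      using that outer' by (cases v) (simp_all add: Y)
    then have "saturated b (upper_to_middle -` W) \<longleftrightarrow> saturated b (two_rows Y Z)"
      by (rule saturated_cong[OF partitionsD[OF b]])
    ultimately show ?thesis by (simp add: closed_product_edges_iff)
  qed
  have "saturated (partition_product m t a b) (two_rows X Z) \<longleftrightarrow>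
      (\<exists>W. product_edges a b `` W \<subseteq> W \<and> W \<inter> vertices m t = two_rows X Z)"
    unfolding partition_product_def
    by (rule saturated_components_iff[OF sym_product_edges two_rows_subset_vertices[OF X Z]])
  also have "\<dots> \<longleftrightarrow> (\<exists>Y\<subseteq>{1..n}. saturated a (two_rows X Y) \<and> saturated b (two_rows Y Z))"
  proof
    assume "\<exists>W. product_edges a b `` W \<subseteq> W \<and> W \<inter> vertices m t = two_rows X Z"
    then obtain W where "product_edges a b `` W \<subseteq> W" "W \<inter> vertices m t = two_rows X Z"
      by blast
    then have "saturated a (two_rows X ({1..n} \<inter> Middle -` W))"
      "saturated b (two_rows ({1..n} \<inter> Middle -` W) Z)"
      using halves[OF _ refl] by simp_all
    then show "\<exists>Y\<subseteq>{1..n}. saturated a (two_rows X Y) \<and> saturated b (two_rows Y Z)"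
      by (meson Int_lower1)
  next
    assume "\<exists>Y\<subseteq>{1..n}. saturated a (two_rows X Y) \<and> saturated b (two_rows Y Z)"
    then obtain Y where Y: "Y \<subseteq> {1..n}" "saturated a (two_rows X Y)" "saturated b (two_rows Y Z)"
      by blast
    let ?W = "two_rows X Z \<union> Middle ` Y"
    have W: "?W \<inter> vertices m t = two_rows X Z"
    proof (rule Set.set_eqI)
      show "v \<in> ?W \<inter> vertices m t \<longleftrightarrow> v \<in> two_rows X Z" for v
        using X Z by (cases v) auto
    qed
    moreover have "Y = {1..n} \<inter> Middle -` ?W"
      using Y(1) by auto
    ultimately show "\<exists>W. product_edges a b `` W \<subseteq> W \<and> W \<inter> vertices m t = two_rows X Z"
      using halves[of ?W Y] Y(2,3) by blast
  qed
  finally show ?thesis .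
qed

text \<open>The category axioms need no further work with graphs: both sides have the same saturated sets
  because composition of relations is associative with equality as unit.\<close>

lemma partition_product_assoc:
  assumes "a \<in> partitions m n" "b \<in> partitions n s" "c \<in> partitions s t"
  shows "partition_product m t (partition_product m s a b) c =
    partition_product m t a (partition_product n t b c)"
proof (rule partitions_eqI[OF partition_product_in_partitions partition_product_in_partitions])
  fix X Z assume X: "X \<subseteq> {1..m}" and Z: "Z \<subseteq> {1..t}"
  show "saturated (partition_product m t (partition_product m s a b) c) (two_rows X Z) \<longleftrightarrow>
      saturated (partition_product m t a (partition_product n t b c)) (two_rows X Z)"
    using saturated_product_iff[OF partition_product_in_partitions assms(3) X Z]
      saturated_product_iff[OF assms(1) partition_product_in_partitions X Z]
      saturated_product_iff[OF assms(1,2) X] saturated_product_iff[OF assms(2,3) _ Z]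
    by metis
qed

lemma partition_product_id_left:
  assumes "a \<in> partitions m n"
  shows "partition_product m n (partition_id m) a = a"
proof (rule partitions_eqI[OF partition_product_in_partitions assms])
  fix X Y assume X: "X \<subseteq> {1..m}" and Y: "Y \<subseteq> {1..n}"
  show "saturated (partition_product m n (partition_id m) a) (two_rows X Y) \<longleftrightarrow>
      saturated a (two_rows X Y)"
    using saturated_product_iff[OF partition_id_in_partitions assms X Y] saturated_id_iff[OF X] X
    by metis
qed

lemma partition_product_id_right:
  assumes "a \<in> partitions m n"
  shows "partition_product m n a (partition_id n) = a"
proof (rule partitions_eqI[OF partition_product_in_partitions assms])
  fix X Y assume X: "X \<subseteq> {1..m}" and Y: "Y \<subseteq> {1..n}"
  show "saturated (partition_product m n a (partition_id n)) (two_rows X Y) \<longleftrightarrow>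
      saturated a (two_rows X Y)"
    using saturated_product_iff[OF assms partition_id_in_partitions X Y] saturated_id_iff[OF _ Y] Y
    by metis
qed

lemma vertices_inject: "vertices m n = vertices m' n' \<Longrightarrow> m = m' \<and> n = n'"
proof -
  assume eq: "vertices m n = vertices m' n'"
  have "{1..m} = Upper -` vertices m n" "{1..n} = Lower -` vertices m n" for m n
    by (auto simp: vertices_def)
  then have "{1..m} = {1..m'}" "{1..n} = {1..n'}" using eq by metis+
  then show "m = m' \<and> n = n'" by (metis card_atLeastAtMost diff_Suc_1)
qed

lemma partitions_inject: "a \<in> partitions m n \<Longrightarrow> a \<in> partitions m' n' \<Longrightarrow> m = m' \<and> n = n'"
  using vertices_inject partition_onD1 by (metis partitionsD)

lemma is_tensor_cat_partition_cat: "is_tensor_cat partition_cat"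
  using partition_product_in_partitions partition_product_assoc partition_id_in_partitions
    partition_product_id_left partition_product_id_right partition_star_in_partitions
    partition_tensor_in_partitions
  unfolding is_tensor_cat_def is_category_def partition_cat_def
  by (auto dest: partitions_inject)

lemma is_tensor_cat_matrix_cat: "is_tensor_cat (matrix_cat :: (nat, 'k::semiring_1 mat) tensor_cat)"
  unfolding is_tensor_cat_def is_category_def matrix_cat_def
  by (auto simp: kronecker_def)

section \<open>Matrices indexed by subsets\<close>

lemma subset_index_less: "X \<subseteq> {1..n} \<Longrightarrow> subset_index n X < 2 ^ n"
  using bij_betw_subset_index[of n] by (auto simp: bij_betw_def)

lemma mat_eq_by_subsetsI:
  assumes "A \<in> carrier_mat (2 ^ m) (2 ^ n)" "B \<in> carrier_mat (2 ^ m) (2 ^ n)"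
    and "\<And>X Y. X \<subseteq> {1..m} \<Longrightarrow> Y \<subseteq> {1..n} \<Longrightarrow>
      A $$ (subset_index m X, subset_index n Y) = B $$ (subset_index m X, subset_index n Y)"
  shows "A = B"
proof (rule eq_matI)
  have surj: "\<exists>X\<subseteq>{1..k}. i = subset_index k X" if "i < 2 ^ k" for i k
    using that bij_betw_subset_index[of k] unfolding bij_betw_def by auto
  show "A $$ (i, j) = B $$ (i, j)" if "i < dim_row B" "j < dim_col B" for i j
    using that assms surj[of i m] surj[of j n] by auto
qed (use assms in auto)

lemma bar_carrier: "bar m n a \<in> carrier_mat (2 ^ m) (2 ^ n)"
  by (simp add: bar_def)

lemma bar_entry_saturated:
  assumes "a \<in> partitions m n" "X \<subseteq> {1..m}" "Y \<subseteq> {1..n}"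
  shows "bar m n a $$ (subset_index m X, subset_index n Y) =
    (of_bool (saturated a (two_rows X Y)) :: 'k::semiring_1)"
  unfolding bar_entry[OF assms(2,3)]
  using union_of_blocks_iff_saturated[OF partitionsD[OF assms(1)]
      two_rows_subset_vertices[OF assms(2,3)]]
  by (simp add: two_rows_def)

lemma times_mat_entry_subsets:
  assumes "A \<in> carrier_mat (2 ^ m) (2 ^ n)" "B \<in> carrier_mat (2 ^ n) (2 ^ t)"
    and "X \<subseteq> {1..m}" "Z \<subseteq> {1..t}"
  shows "(A * B) $$ (subset_index m X, subset_index t Z) =
    (\<Sum>Y\<in>Pow {1..n}. A $$ (subset_index m X, subset_index n Y) *
      B $$ (subset_index n Y, subset_index t Z))"
proof -
  have "(A * B) $$ (subset_index m X, subset_index t Z) =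
      (\<Sum>k<2 ^ n. A $$ (subset_index m X, k) * B $$ (k, subset_index t Z))"
    using assms subset_index_less[OF assms(3)] subset_index_less[OF assms(4)]
    by (simp add: scalar_prod_def lessThan_atLeast0)
  also have "\<dots> = (\<Sum>Y\<in>Pow {1..n}. A $$ (subset_index m X, subset_index n Y) *
      B $$ (subset_index n Y, subset_index t Z))"
    by (rule sum.reindex_bij_betw[OF bij_betw_subset_index, symmetric])
  finally show ?thesis .
qed

lemma idempotent_sum_of_bool:
  assumes "(1::'k::semiring_1) + 1 = 1" "finite S"
  shows "(\<Sum>x\<in>S. of_bool (P x)) = (of_bool (\<exists>x\<in>S. P x) :: 'k)"
  using assms(2)
proof induction
  case (insert x S)
  have "(\<Sum>x\<in>insert x S. of_bool (P x)) = (of_bool (P x) + of_bool (\<exists>x\<in>S. P x) :: 'k)"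
    by (simp only: sum.insert[OF insert.hyps] insert.IH)
  also have "\<dots> = of_bool (\<exists>x\<in>insert x S. P x)"
    using assms(1) by (cases "P x"; cases "\<exists>x\<in>S. P x") simp_all
  finally show ?case .
qed simp

text \<open>The subset \<open>X \<union> (U + m)\<close> has the binary digits of \<open>X\<close> followed by those of \<open>U\<close>, so its index
  has quotient and remainder modulo \<open>2 ^ s\<close> as in the Kronecker product.\<close>

lemma subset_index_append:
  assumes "X \<subseteq> {1..m}" "U \<subseteq> {1..s}"
  shows "subset_index (m + s) (X \<union> (\<lambda>x. x + m) ` U) = subset_index m X * 2 ^ s + subset_index s U"
proof -
  have fin: "finite X" "finite U" using assms finite_subset by blast+
  have "X \<inter> (\<lambda>x. x + m) ` U = {}" using assms by fastforce
  then have "subset_index (m + s) (X \<union> (\<lambda>x. x + m) ` U) =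
      (\<Sum>x\<in>X. 2 ^ (m + s - x)) + (\<Sum>x\<in>(\<lambda>x. x + m) ` U. 2 ^ (m + s - x))"
    using fin by (simp add: subset_index_def sum.union_disjoint)
  also have "(\<Sum>x\<in>X. (2::nat) ^ (m + s - x)) = (\<Sum>x\<in>X. 2 ^ (m - x) * 2 ^ s)"
  proof (rule sum.cong)
    fix x assume "x \<in> X"
    then have "m + s - x = (m - x) + s" using assms(1) by fastforce
    then show "(2::nat) ^ (m + s - x) = 2 ^ (m - x) * 2 ^ s" by (simp add: power_add)
  qed simp
  also have "(\<Sum>x\<in>(\<lambda>x. x + m) ` U. (2::nat) ^ (m + s - x)) = (\<Sum>x\<in>U. 2 ^ (s - x))"
    by (simp add: sum.reindex)
  finally show ?thesis by (simp add: subset_index_def sum_distrib_right)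
qed

lemma subset_atLeastAtMost_add_cases:
  fixes X :: "nat set"
  assumes "X \<subseteq> {1..m + s}"
  obtains X' U where "X' \<subseteq> {1..m}" "U \<subseteq> {1..s}" "X = X' \<union> (\<lambda>x. x + m) ` U"
proof
  show "X \<inter> {1..m} \<subseteq> {1..m}" by blast
  show "{x \<in> {1..s}. x + m \<in> X} \<subseteq> {1..s}" by blast
  have "x \<in> (\<lambda>x. x + m) ` {x \<in> {1..s}. x + m \<in> X}" if "x \<in> X" "\<not> x \<le> m" for x
    using that assms by (intro image_eqI[of _ _ "x - m"]) auto
  then show "X = X \<inter> {1..m} \<union> (\<lambda>x. x + m) ` {x \<in> {1..s}. x + m \<in> X}"
    using assms by fastforce
qed

lemma kronecker_carrier:
  "A \<in> carrier_mat p q \<Longrightarrow> B \<in> carrier_mat p' q' \<Longrightarrow> kronecker A B \<in> carrier_mat (p * p') (q * q')"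
  by (auto simp: kronecker_def)

lemma kronecker_entry_subsets:
  assumes "A \<in> carrier_mat (2 ^ m) (2 ^ n)" "B \<in> carrier_mat (2 ^ s) (2 ^ t)"
    and "X \<subseteq> {1..m}" "Y \<subseteq> {1..n}" "U \<subseteq> {1..s}" "V \<subseteq> {1..t}"
  shows "kronecker A B $$ (subset_index (m + s) (X \<union> (\<lambda>x. x + m) ` U),
      subset_index (n + t) (Y \<union> (\<lambda>x. x + n) ` V)) =
    A $$ (subset_index m X, subset_index n Y) * B $$ (subset_index s U, subset_index t V)"
proof -
  have bound: "i * 2 ^ k + j < 2 ^ l * 2 ^ k" if "i < 2 ^ l" "j < 2 ^ k" for i j k l :: nat
  proof -
    have "i * 2 ^ k + j < (i + 1) * 2 ^ k" using that by simp
    also have "\<dots> \<le> 2 ^ l * 2 ^ k" using that by (intro mult_le_mono1) simp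
    finally show ?thesis .
  qed
  show ?thesis
    using assms(1,2) assms(3-6)[THEN subset_index_less]
    by (simp add: kronecker_def subset_index_append[OF assms(3,5)]
        subset_index_append[OF assms(4,6)] bound power_add)
qed

section \<open>The representation\<close>

text \<open>The sum over the middle index \<open>Y\<close> counts the sets \<open>Y\<close> of \<open>saturated_product_iff\<close>, and
  idempotency reduces this number to whether such a set exists.\<close>

lemma bar_product:
  assumes idem: "(1::'k::semiring_1) + 1 = 1"
    and a: "a \<in> partitions m n" and b: "b \<in> partitions n t"
  shows "bar m t (partition_product m t a b) = (bar m n a * bar n t b :: 'k mat)"
proof (rule mat_eq_by_subsetsI[OF bar_carrier mult_carrier_mat[OF bar_carrier bar_carrier]])
  fix X Z assume X: "X \<subseteq> {1..m}" and Z: "Z \<subseteq> {1..t}"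
  have "(bar m n a * bar n t b) $$ (subset_index m X, subset_index t Z) =
      (\<Sum>Y\<in>Pow {1..n}. of_bool (saturated a (two_rows X Y) \<and> saturated b (two_rows Y Z)) :: 'k)"
    unfolding times_mat_entry_subsets[OF bar_carrier bar_carrier X Z]
    by (intro sum.cong) (simp_all add: bar_entry_saturated[OF a X] bar_entry_saturated[OF b _ Z] of_bool_conj)
  also have "\<dots> = of_bool (\<exists>Y\<in>Pow {1..n}. saturated a (two_rows X Y) \<and> saturated b (two_rows Y Z))"
    by (rule idempotent_sum_of_bool[OF idem]) simp
  also have "\<dots> = of_bool (saturated (partition_product m t a b) (two_rows X Z))"
    using saturated_product_iff[OF a b X Z] by (simp add: Bex_def)
  finally show "bar m t (partition_product m t a b) $$ (subset_index m X, subset_index t Z) =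
      ((bar m n a * bar n t b) $$ (subset_index m X, subset_index t Z) :: 'k)"
    by (simp add: bar_entry_saturated[OF partition_product_in_partitions X Z])
qed

lemma bar_id: "bar n n (partition_id n) = (1\<^sub>m (2 ^ n) :: 'k::semiring_1 mat)"
proof (rule mat_eq_by_subsetsI[OF bar_carrier one_carrier_mat])
  fix X Y assume X: "X \<subseteq> {1..n}" and Y: "Y \<subseteq> {1..n}"
  have "subset_index n X = subset_index n Y \<longleftrightarrow> X = Y"
    using bij_betw_subset_index[of n] X Y by (auto simp: bij_betw_def inj_on_def)
  then show "bar n n (partition_id n) $$ (subset_index n X, subset_index n Y) =
      (1\<^sub>m (2 ^ n) $$ (subset_index n X, subset_index n Y) :: 'k)"
    by (simp add: bar_entry_saturated[OF partition_id_in_partitions X Y] saturated_id_iff[OF X Y]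
        subset_index_less[OF X] subset_index_less[OF Y])
qed

lemma bar_star:
  assumes "a \<in> partitions m n"
  shows "bar n m (partition_star a) = (transpose_mat (bar m n a) :: 'k::semiring_1 mat)"
proof (rule mat_eq_by_subsetsI[OF bar_carrier])
  show "transpose_mat (bar m n a) \<in> carrier_mat (2 ^ n) (2 ^ m)"
    using bar_carrier[of m n a] by simp
  fix X Y assume XY: "X \<subseteq> {1..n}" "Y \<subseteq> {1..m}"
  show "bar n m (partition_star a) $$ (subset_index n X, subset_index m Y) =
      (transpose_mat (bar m n a) $$ (subset_index n X, subset_index m Y) :: 'k)"
    using bar_carrier[of m n a, where ?'a = 'k]
    by (simp add: bar_entry_saturated[OF partition_star_in_partitions[OF assms] XY]
        bar_entry_saturated[OF assms XY(2,1)] saturated_star_iff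
        subset_index_less[OF XY(1)] subset_index_less[OF XY(2)])
qed

lemma bar_tensor:
  assumes a: "a \<in> partitions m n" and b: "b \<in> partitions s t"
  shows "bar (m + s) (n + t) (partition_tensor m n a b) =
    (kronecker (bar m n a) (bar s t b) :: 'k::semiring_1 mat)"
proof (rule mat_eq_by_subsetsI[OF bar_carrier])
  show "kronecker (bar m n a) (bar s t b) \<in> carrier_mat (2 ^ (m + s)) (2 ^ (n + t))"
    unfolding power_add by (rule kronecker_carrier[OF bar_carrier bar_carrier])
  fix X' Y' assume X': "X' \<subseteq> {1..m + s}" and Y': "Y' \<subseteq> {1..n + t}"
  obtain X U where X: "X \<subseteq> {1..m}" "U \<subseteq> {1..s}" "X' = X \<union> (\<lambda>x. x + m) ` U"
    using X' by (rule subset_atLeastAtMost_add_cases)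
  obtain Y V where Y: "Y \<subseteq> {1..n}" "V \<subseteq> {1..t}" "Y' = Y \<union> (\<lambda>x. x + n) ` V"
    using Y' by (rule subset_atLeastAtMost_add_cases)
  have "saturated (partition_tensor m n a b) (two_rows X' Y') \<longleftrightarrow>
      saturated a (two_rows X Y) \<and> saturated b (two_rows U V)"
    unfolding X(3) Y(3) using saturated_tensor_iff[OF a b X(1) Y(1) X(2) Y(2)] .
  then show "bar (m + s) (n + t) (partition_tensor m n a b) $$
        (subset_index (m + s) X', subset_index (n + t) Y') =
      (kronecker (bar m n a) (bar s t b) $$ (subset_index (m + s) X', subset_index (n + t) Y') :: 'k)"
    using kronecker_entry_subsets[OF bar_carrier bar_carrier X(1) Y(1) X(2) Y(2),
        of a b, where ?'a = 'k]
    by (simp add: bar_entry_saturated[OF partition_tensor_in_partitions[OF a b] X' Y']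
        bar_entry_saturated[OF a X(1) Y(1)] bar_entry_saturated[OF b X(2) Y(2)] of_bool_conj
        flip: X(3) Y(3))
qed

lemma bar_inject:
  assumes a: "a \<in> partitions m n" and b: "b \<in> partitions m' n'"
    and eq: "bar m n a = (bar m' n' b :: 'k::semiring_1 mat)"
  shows "m = m' \<and> n = n' \<and> a = b"
proof -
  have "(2::nat) ^ m = 2 ^ m'" "(2::nat) ^ n = 2 ^ n'"
    using eq bar_carrier[of m n a, where ?'a = 'k] bar_carrier[of m' n' b, where ?'a = 'k]
    by (auto dest: carrier_matD)
  then have mn: "m = m'" "n = n'" by simp_all
  have "a = b"
  proof (rule partitions_eqI[OF a])
    show b': "b \<in> partitions m n" using b mn by simp
    show "saturated a (two_rows X Y) \<longleftrightarrow> saturated b (two_rows X Y)"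
      if "X \<subseteq> {1..m}" "Y \<subseteq> {1..n}" for X Y
      using bar_entry_saturated[OF a that, where ?'k = 'k]
        bar_entry_saturated[OF b' that, where ?'k = 'k] eq mn
      by (metis of_bool_eq_iff)
  qed
  then show ?thesis using mn by simp
qed

lemma monoid_endo_monoid:
  assumes "is_category C"
  shows "monoid (endo_monoid C n)"
  using assms unfolding is_category_def endo_monoid_def by (intro monoidI) auto

theorem theorem3p11:
  fixes M :: "(nat, 'k::semiring_1 mat) tensor_cat"
    and \<phi> :: "nat \<Rightarrow> nat \<Rightarrow> vertex set set \<Rightarrow> 'k mat"
  assumes idempotent: "(1::'k) + 1 = 1"
    and M: "M = matrix_cat"
    and phi: "\<phi> = bar"
  shows "(is_tensor_cat partition_cat \<and> is_tensor_cat M \<and>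
      is_functor partition_cat M (\<lambda>n. 2 ^ n) \<phi> \<and>
      faithful_map partition_cat (\<lambda>n. 2 ^ n :: nat) \<phi> \<and>
      involutive_map partition_cat M (\<lambda>n. 2 ^ n) \<phi> \<and>
      tensor_map partition_cat M (\<lambda>n. 2 ^ n) \<phi>) \<and>
    (\<forall>n. monoid (endo_monoid partition_cat n) \<and> monoid (endo_monoid M (2 ^ n)) \<and>
      \<phi> n n \<in> hom (endo_monoid partition_cat n) (endo_monoid M (2 ^ n)) \<and>
      \<phi> n n \<one>\<^bsub>endo_monoid partition_cat n\<^esub> = \<one>\<^bsub>endo_monoid M (2 ^ n)\<^esub> \<and>
      inj_on (\<phi> n n) (carrier (endo_monoid partition_cat n)) \<and>
      (\<forall>a \<in> carrier (endo_monoid partition_cat n).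
        \<phi> n n (star_of partition_cat n n a) = star_of M (2 ^ n) (2 ^ n) (\<phi> n n a)))"
proof -
  have tensor_cats: "is_tensor_cat partition_cat" "is_tensor_cat M"
    by (simp_all add: M is_tensor_cat_partition_cat is_tensor_cat_matrix_cat)
  then have cats: "is_category partition_cat" "is_category M"
    by (simp_all add: is_tensor_cat_def)
  have is_funct: "is_functor partition_cat M (\<lambda>n. 2 ^ n) \<phi>"
    using cats bar_carrier bar_product[OF idempotent] bar_id
    by (auto simp: is_functor_def M phi partition_cat_def matrix_cat_def)
  have faithful: "faithful_map partition_cat (\<lambda>n. 2 ^ n :: nat) \<phi>"
    using bar_inject unfolding faithful_map_def phi partition_cat_def
    by (fastforce simp: inj_def)
  have involutive: "involutive_map partition_cat M (\<lambda>n. 2 ^ n) \<phi>"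
    using bar_star by (auto simp: involutive_map_def M phi partition_cat_def matrix_cat_def)
  have tensor: "tensor_map partition_cat M (\<lambda>n. 2 ^ n) \<phi>"
    using bar_tensor
    by (auto simp: tensor_map_def M phi partition_cat_def matrix_cat_def power_add)
  have endo: "\<phi> n n \<in> hom (endo_monoid partition_cat n) (endo_monoid M (2 ^ n))"
    "\<phi> n n \<one>\<^bsub>endo_monoid partition_cat n\<^esub> = \<one>\<^bsub>endo_monoid M (2 ^ n)\<^esub>"
    "inj_on (\<phi> n n) (carrier (endo_monoid partition_cat n))"
    "\<forall>a \<in> carrier (endo_monoid partition_cat n).
      \<phi> n n (star_of partition_cat n n a) = star_of M (2 ^ n) (2 ^ n) (\<phi> n n a)" for n
    using is_funct faithful involutive
    unfolding is_functor_def faithful_map_def involutive_map_def endo_monoid_def hom_def inj_on_def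
    by auto
  show ?thesis
    by (intro conjI allI tensor_cats is_funct faithful involutive tensor monoid_endo_monoid cats endo)
qed

end
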